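(* Consider a single (covering) DRCCP under the type $\infty$-Wasserstein ambiguity set with affine mappings $a_1(x)=-x$, $b_1(x)=-b_1\le0$ (a constant), deterministic set $\mathcal X\subseteq\{0,1\}^n$, and random parameters $\tilde\zeta=(\tilde\zeta_1,\dots,\tilde\zeta_n)$ whose components are i.i.d. and nonnegative. Then ALSO-X# is exact, i.e., $v^{A\#}=v^*$.
   Context: $c\in\mathbb{R}^n$, $b_1\ge0$, $\varepsilon\in(0,1)$, $\theta\ge0$, $(y)_+=\max\{y,0\}$. The reference distribution $\mathbb{P}_\zeta$ of $\tilde\zeta$ is assumed sub-Gaussian. The support set is $\Xi=\mathbb{R}^n_+$ and the norm is an $\ell_p$ norm $\|\cdot\|_p$ on $\mathbb{R}^n$ ($p\in[1,\infty]$). For $x\in\mathcal X$ and $\zeta\in\mathbb{R}^n_+$ put $$g(x,\zeta)=b_1-\min_{\xi\in\mathbb{R}^n_+}\Big\{\sum_{i=1}^n\xi_ix_i:\ \|\xi-\zeta\|_p\le\theta\Big\}.$$ DRCCP (equivalent form of $\min_{x\in\mathcal X}\{c^\top x:\inf_{\mathbb{P}\in\mathcal P_\infty}\mathbb{P}\{x^\top\tilde\xi\ge b_1\}\ge1-\varepsilon\}$): $v^*=\min\{c^\top x:x\in\mathcal X,\ \mathbb{P}_\zeta\{g(x,\tilde\zeta)\le0\}\ge1-\varepsilon\}$. ALSO-X#: $v^{A\#}$ is the minimum (infimum) of all $t$ for which there is $(x^*,\beta^* )\in\arg\min\{\varepsilon\beta+\mathbb{E}_{\mathbb{P}_\zeta}[(g(x,\tilde\zeta)-\beta)_+]:x\in\mathcal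 X,\ c^\top x\le t,\ \beta\le0\}$ with $\mathbb{P}_\zeta\{g(x^*,\tilde\zeta)\le0\}\ge1-\varepsilon$. A minimum or infimum over the empty set is $+\infty$. *)

theory Defs
  imports "HOL-Probability.Probability"
begin

definition lp_norm :: "ennreal \<Rightarrow> real ^ 'n \<Rightarrow> real" where
  "lp_norm p x =
     (if p = \<infinity> then infnorm x
      else (\<Sum>i\<in>UNIV. \<bar>x $ i\<bar> powr enn2real p) powr (1 / enn2real p))"

definition nonneg_orthant :: "(real ^ 'n) set" where
  "nonneg_orthant = {\<xi>. \<forall>i. 0 \<le> \<xi> $ i}"

text \<open>Sub-Gaussianity as a Gaussian tail bound. The choice of norm is immaterial in finite
  dimension, since changing it only changes the constants.\<close>

definition sub_gaussian :: "(real ^ 'n) measure \<Rightarrow> bool" where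
  "sub_gaussian P \<longleftrightarrow>
     (\<exists>C1>0. \<exists>C2>0. \<forall>t\<ge>0. \<P>(\<zeta> in P. norm \<zeta> \<ge> t) \<le> C1 * exp (- C2 * t\<^sup>2))"

text \<open>The worst-case violation of the covering constraint \<open>x \<bullet> \<xi> \<ge> b1\<close>: it is at most 0 iff the constraint
  holds for all nonnegative \<open>\<xi>\<close> within distance \<open>\<theta>\<close> of \<open>\<zeta>\<close>.
  For \<open>\<zeta>\<close> in the nonnegative orthant and \<open>\<theta> \<ge> 0\<close> the feasible set below is nonempty and
  compact, so the infimum is a minimum. For other \<open>\<zeta>\<close> (a null set for the distributions
  considered) the feasible set may be empty, and the value is then irrelevant.\<close>

definition robust_violation ::
    "ennreal \<Rightarrow> real \<Rightarrow> real \<Rightarrow> real ^ 'n \<Rightarrow> real ^ 'n \<Rightarrow> real" where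
  "robust_violation p \<theta> b1 x \<zeta> =
     b1 - (INF \<xi>\<in>{\<xi> \<in> nonneg_orthant. lp_norm p (\<xi> - \<zeta>) \<le> \<theta>}. \<Sum>i\<in>UNIV. \<xi> $ i * x $ i)"

text \<open>Optimal values are infima in the extended reals, so that an infeasible problem has
  value \<open>\<infinity>\<close>.\<close>

definition drccp_value ::
    "(real ^ 'n) measure \<Rightarrow> ennreal \<Rightarrow> real \<Rightarrow> real \<Rightarrow> real \<Rightarrow> (real ^ 'n) set \<Rightarrow> real ^ 'n \<Rightarrow> ereal"
  where
  "drccp_value P p \<theta> b1 \<epsilon> X c =
     (INF x\<in>{x \<in> X. \<P>(\<zeta> in P. robust_violation p \<theta> b1 x \<zeta> \<le> 0) \<ge> 1 - \<epsilon>}. ereal (c \<bullet> x))"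

definition also_x_sharp_objective ::
    "(real ^ 'n) measure \<Rightarrow> ennreal \<Rightarrow> real \<Rightarrow> real \<Rightarrow> real \<Rightarrow> (real ^ 'n) \<times> real \<Rightarrow> real" where
  "also_x_sharp_objective P p \<theta> b1 \<epsilon> = (\<lambda>(x, \<beta>).
     \<epsilon> * \<beta> + (\<integral>\<zeta>. max (robust_violation p \<theta> b1 x \<zeta> - \<beta>) 0 \<partial>P))"

definition also_x_sharp_value ::
    "(real ^ 'n) measure \<Rightarrow> ennreal \<Rightarrow> real \<Rightarrow> real \<Rightarrow> real \<Rightarrow> (real ^ 'n) set \<Rightarrow> real ^ 'n \<Rightarrow> ereal"
  where
  "also_x_sharp_value P p \<theta> b1 \<epsilon> X c =
     (INF t\<in>{t :: real. \<exists>x \<beta>.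
          is_arg_min (also_x_sharp_objective P p \<theta> b1 \<epsilon>)
            (\<lambda>(x, \<beta>). x \<in> X \<and> c \<bullet> x \<le> t \<and> \<beta> \<le> 0) (x, \<beta>) \<and>
          \<P>(\<zeta> in P. robust_violation p \<theta> b1 x \<zeta> \<le> 0) \<ge> 1 - \<epsilon>}. ereal t)"

end

theory Submission
  imports Defs
begin

text \<open>
  A binary decision \<open>x\<close> enters the constraint only through its support, and because the \<open>\<zeta>\<^sub>i\<close> are
  independent and identically distributed, the law of \<open>\<zeta>\<close> is invariant under permutations of the
  coordinates (\<open>distr_reindex_vec_iid\<close>). The \<open>p\<close>-norm and the orthant are invariant as well, so the
  law of the robust violation \<open>g x \<zeta>\<close> depends only on the size of the support of \<open>x\<close>. Since
  \<open>\<xi> \<ge> 0\<close>, a larger support only lowers the violation. Hence the decisions are totally ordered by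
  support size: a larger one is at least as good for the ALSO-X# objective at every \<open>\<beta>\<close> and has at
  least as large a probability of satisfying the constraint.

  Now let \<open>y\<close> be feasible for the chance-constrained problem and take the budget \<open>t = c \<bullet> y\<close>. Among
  the decisions within the budget choose one, \<open>x\<close>, of largest support. By the ordering, \<open>x\<close> together
  with its best \<open>\<beta> \<le> 0\<close> solves the ALSO-X# lower-level problem, and \<open>x\<close> satisfies the chance
  constraint because \<open>y\<close> does. So ALSO-X# accepts the budget \<open>t\<close>. Conversely, any budget accepted by
  ALSO-X# is at least the cost of a feasible decision, by definition.

  The remaining work is analytic. The best \<open>\<beta>\<close> exists because the objective is continuous in \<open>\<beta>\<close>
  and tends to infinity as \<open>\<beta>\<close> tends to minus infinity, which is where \<open>\<epsilon> < 1\<close> enters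
  (\<open>also_x_sharp_objective_attains_min_beta\<close>). Comparing expectations and probabilities requires
  the violation to be measurable and integrable. Measurability holds because the set of \<open>\<zeta>\<close> from
  which a given closed set can be reached by an admissible perturbation is closed, and
  integrability because the violation grows at most linearly and sub-Gaussian vectors have a
  finite first moment.
\<close>

section \<open>Balls of the p-norm\<close>

lemma enn2real_pos_if_ge_1:
  assumes "p \<ge> (1::ennreal)" "p \<noteq> \<infinity>"
  shows "0 < enn2real p"
proof -
  have "enn2real 1 \<le> enn2real p"
    using assms by (intro enn2real_mono) (auto simp: top.not_eq_extremum)
  then show ?thesis by simp
qed

lemma component_le_lp_norm:
  fixes x :: "real ^ 'n"
  assumes "p \<ge> 1"
  shows "\<bar>x $ i\<bar> \<le> lp_norm p x"
proof (cases "p = \<infinity>")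
  case True
  then show ?thesis by (simp add: lp_norm_def component_le_infnorm_cart)
next
  case False
  define q where "q = enn2real p"
  have q: "0 < q" using enn2real_pos_if_ge_1[OF assms False] by (simp add: q_def)
  have "\<bar>x $ i\<bar> = (\<bar>x $ i\<bar> powr q) powr (1 / q)"
    using q by (simp add: powr_powr)
  also have "\<dots> \<le> (\<Sum>j\<in>UNIV. \<bar>x $ j\<bar> powr q) powr (1 / q)"
    using q by (intro powr_mono2 member_le_sum) auto
  finally show ?thesis using False by (simp add: lp_norm_def q_def)
qed

lemma continuous_on_lp_norm:
  fixes A :: "(real ^ 'n) set"
  assumes "p \<ge> 1"
  shows "continuous_on A (lp_norm p)"
proof (cases "p = \<infinity>")
  case True
  then have "lp_norm p = (\<lambda>x :: real ^ 'n. infnorm x)" by (simp add: lp_norm_def fun_eq_iff)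
  then show ?thesis by (simp only:) (intro continuous_intros)
next
  case False
  have q: "0 < enn2real p" using enn2real_pos_if_ge_1[OF assms False] .
  have "continuous_on A
          (\<lambda>x::real ^ 'n. (\<Sum>i\<in>UNIV. \<bar>x $ i\<bar> powr enn2real p) powr (1 / enn2real p))"
    using q by (intro continuous_intros continuous_on_powr') (auto intro: sum_nonneg)
  then show ?thesis using False by (simp add: lp_norm_def[abs_def])
qed

lemma lp_norm_zero: "p \<ge> 1 \<Longrightarrow> lp_norm p 0 = 0"
  by (simp add: lp_norm_def infnorm_0)

lemma compact_lp_ball:
  assumes "p \<ge> 1"
  shows "compact {x :: real ^ 'n. lp_norm p x \<le> r}"
proof -
  have "closed {x :: real ^ 'n. lp_norm p x \<le> r}"
    by (intro closed_Collect_le continuous_on_lp_norm[OF assms] continuous_on_const)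
  moreover have "norm x \<le> real CARD('n) * r" if "lp_norm p x \<le> r" for x :: "real ^ 'n"
  proof -
    have "norm x \<le> (\<Sum>i\<in>UNIV. \<bar>x $ i\<bar>)" by (rule norm_le_l1_cart)
    also have "\<dots> \<le> (\<Sum>i\<in>(UNIV :: 'n set). r)"
      using component_le_lp_norm[OF assms, of x] that by (intro sum_mono) (meson order_trans)
    finally show ?thesis by simp
  qed
  then have "bounded {x :: real ^ 'n. lp_norm p x \<le> r}"
    unfolding bounded_iff by blast
  ultimately show ?thesis by (simp add: compact_eq_bounded_closed)
qed

section \<open>The robust violation as a function of the parameters\<close>

definition perturbations :: "ennreal \<Rightarrow> real \<Rightarrow> real ^ 'n \<Rightarrow> (real ^ 'n) set" where
  "perturbations p \<theta> \<zeta> = {\<xi> \<in> nonneg_orthant. lp_norm p (\<xi> - \<zeta>) \<le> \<theta>}"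

lemma robust_violation_eq:
  "robust_violation p \<theta> b x \<zeta> = b - (INF \<xi>\<in>perturbations p \<theta> \<zeta>. \<xi> \<bullet> x)"
  by (simp add: robust_violation_def perturbations_def inner_vec_def)

lemma closed_nonneg_orthant: "closed (nonneg_orthant :: (real ^ 'n) set)"
proof -
  have "nonneg_orthant = (\<Inter>i. {x :: real ^ 'n. 0 \<le> x $ i})"
    by (auto simp: nonneg_orthant_def)
  also have "closed \<dots>"
    by (intro closed_INT ballI closed_halfspace_component_ge_cart)
  finally show ?thesis .
qed

lemma inner_nonneg_orthant: "x \<in> nonneg_orthant \<Longrightarrow> y \<in> nonneg_orthant \<Longrightarrow> 0 \<le> x \<bullet> y"
  by (auto simp: nonneg_orthant_def inner_vec_def intro!: sum_nonneg)

lemma center_in_perturbations: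
  "p \<ge> 1 \<Longrightarrow> \<theta> \<ge> 0 \<Longrightarrow> \<zeta> \<in> nonneg_orthant \<Longrightarrow> \<zeta> \<in> perturbations p \<theta> \<zeta>"
  by (simp add: perturbations_def lp_norm_zero)

lemma bdd_below_perturbations:
  "x \<in> nonneg_orthant \<Longrightarrow> bdd_below ((\<lambda>\<xi>. \<xi> \<bullet> x) ` perturbations p \<theta> \<zeta>)"
  by (rule bdd_belowI2[of _ 0]) (auto simp: perturbations_def inner_nonneg_orthant)

lemma compact_perturbations:
  fixes \<zeta> :: "real ^ 'n"
  assumes "p \<ge> 1"
  shows "compact (perturbations p \<theta> \<zeta>)"
proof -
  have "perturbations p \<theta> \<zeta> = nonneg_orthant \<inter> (\<lambda>\<eta>. \<zeta> + \<eta>) ` {\<eta>. lp_norm p \<eta> \<le> \<theta>}"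
    by (auto simp: perturbations_def intro!: image_eqI[of _ _ "_ - \<zeta>"])
  then show ?thesis
    using closed_Int_compact[OF closed_nonneg_orthant compact_translation[OF compact_lp_ball[OF assms]]]
    by simp
qed

text \<open>By compactness the worst case is attained. A superlevel set of the violation thus consists of
  the \<open>\<zeta>\<close> from which a fixed closed half-space can be reached, the form needed for measurability.\<close>

lemma robust_violation_ge_iff:
  assumes "p \<ge> 1" "perturbations p \<theta> \<zeta> \<noteq> {}" "x \<in> nonneg_orthant"
  shows "a \<le> robust_violation p \<theta> b x \<zeta> \<longleftrightarrow> (\<exists>\<xi>\<in>perturbations p \<theta> \<zeta>. \<xi> \<bullet> x \<le> b - a)"
proof
  assume *: "a \<le> robust_violation p \<theta> b x \<zeta>"
  have "continuous_on (perturbations p \<theta> \<zeta>) (\<lambda>\<xi>. \<xi> \<bullet> x)"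
    by (intro continuous_intros)
  then obtain \<xi> where \<xi>: "\<xi> \<in> perturbations p \<theta> \<zeta>"
      "\<And>\<eta>. \<eta> \<in> perturbations p \<theta> \<zeta> \<Longrightarrow> \<xi> \<bullet> x \<le> \<eta> \<bullet> x"
    using continuous_attains_inf[OF compact_perturbations[OF assms(1)] assms(2)]
    by blast
  have "\<xi> \<bullet> x \<le> (INF \<xi>\<in>perturbations p \<theta> \<zeta>. \<xi> \<bullet> x)"
    using assms(2) \<xi>(2) by (intro cINF_greatest)
  with * \<xi>(1) show "\<exists>\<xi>\<in>perturbations p \<theta> \<zeta>. \<xi> \<bullet> x \<le> b - a"
    by (intro bexI[of _ \<xi>]) (auto simp: robust_violation_eq)
next
  assume "\<exists>\<xi>\<in>perturbations p \<theta> \<zeta>. \<xi> \<bullet> x \<le> b - a"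
  then obtain \<xi> where "\<xi> \<in> perturbations p \<theta> \<zeta>" "\<xi> \<bullet> x \<le> b - a" by blast
  moreover from this have "(INF \<xi>\<in>perturbations p \<theta> \<zeta>. \<xi> \<bullet> x) \<le> \<xi> \<bullet> x"
    by (intro cINF_lower bdd_below_perturbations assms(3))
  ultimately show "a \<le> robust_violation p \<theta> b x \<zeta>"
    by (simp add: robust_violation_eq)
qed

text \<open>The set is the sum of the closed set \<open>nonneg_orthant \<inter> H\<close> and a reflected, compact \<open>p\<close>-ball.\<close>

lemma closed_perturbation_projection:
  fixes H :: "(real ^ 'n) set"
  assumes "p \<ge> 1" "closed H"
  shows "closed {\<zeta>. \<exists>\<xi>\<in>perturbations p \<theta> \<zeta>. \<xi> \<in> H}"
proof -
  have eq: "{\<zeta>. \<exists>\<xi>\<in>perturbations p \<theta> \<zeta>. \<xi> \<in> H}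
      = (\<Union>u\<in>nonneg_orthant \<inter> H. \<Union>v\<in>uminus ` {\<eta>. lp_norm p \<eta> \<le> \<theta>}. {u + v})"
    by (force simp: perturbations_def intro: exI[of _ "_ - _"])
  show ?thesis
    unfolding eq
    using closed_compact_sums[OF closed_Int[OF closed_nonneg_orthant assms(2)]
        compact_negations[OF compact_lp_ball[OF assms(1)]]]
    by simp
qed

lemma borel_measurable_robust_violation:
  fixes x :: "real ^ 'n"
  assumes "p \<ge> 1" "x \<in> nonneg_orthant"
  shows "robust_violation p \<theta> b x \<in> borel_measurable borel"
  unfolding borel_measurable_iff_ge
proof
  fix a :: real
  let ?D = "{\<zeta>. \<exists>\<xi>\<in>perturbations p \<theta> \<zeta>. \<xi> \<in> (UNIV :: (real ^ 'n) set)}"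
  let ?C = "{\<zeta>. \<exists>\<xi>\<in>perturbations p \<theta> \<zeta>. \<xi> \<in> {\<xi>. \<xi> \<bullet> x \<le> b - a}}"
  have "closed ?D" "closed ?C"
    by (intro closed_perturbation_projection assms closed_UNIV closed_Collect_le continuous_intros)+
  \<comment> \<open>Where no admissible perturbation exists, the violation is the constant \<open>b - Inf {}\<close>.\<close>
  moreover have "{\<zeta>. a \<le> robust_violation p \<theta> b x \<zeta>}
      = ?C \<union> (if a \<le> b - Inf {} then - ?D else {})"
  proof (rule set_eqI)
    fix \<zeta>
    show "\<zeta> \<in> {\<zeta>. a \<le> robust_violation p \<theta> b x \<zeta>}
      \<longleftrightarrow> \<zeta> \<in> ?C \<union> (if a \<le> b - Inf {} then - ?D else {})"
    proof (cases "perturbations p \<theta> \<zeta> = {}")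
      case True
      then show ?thesis by (simp add: robust_violation_eq)
    next
      case False
      then show ?thesis using robust_violation_ge_iff[OF assms(1) False assms(2)] by auto
    qed
  qed
  ultimately show "{\<zeta> \<in> space borel. a \<le> robust_violation p \<theta> b x \<zeta>} \<in> sets borel"
    by (auto intro!: sets.Un borel_closed borel_comp)
qed

lemma robust_violation_antimono:
  assumes "p \<ge> 1" "\<theta> \<ge> 0" "\<zeta> \<in> nonneg_orthant" "y \<in> nonneg_orthant" "\<And>i. y $ i \<le> x $ i"
  shows "robust_violation p \<theta> b x \<zeta> \<le> robust_violation p \<theta> b y \<zeta>"
proof -
  have "(INF \<xi>\<in>perturbations p \<theta> \<zeta>. \<xi> \<bullet> y) \<le> (INF \<xi>\<in>perturbations p \<theta> \<zeta>. \<xi> \<bullet> x)"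
  proof (rule cINF_mono)
    show "perturbations p \<theta> \<zeta> \<noteq> {}" using center_in_perturbations[OF assms(1-3)] by blast
    show "bdd_below ((\<lambda>\<xi>. \<xi> \<bullet> y) ` perturbations p \<theta> \<zeta>)"
      by (rule bdd_below_perturbations[OF assms(4)])
    show "\<exists>\<eta>\<in>perturbations p \<theta> \<zeta>. \<eta> \<bullet> y \<le> \<xi> \<bullet> x" if "\<xi> \<in> perturbations p \<theta> \<zeta>" for \<xi>
      using that assms(5)
      by (intro bexI[of _ \<xi>])
        (auto simp: perturbations_def nonneg_orthant_def inner_vec_def intro!: sum_mono mult_left_mono)
  qed
  then show ?thesis by (simp add: robust_violation_eq)
qed

lemma abs_robust_violation_le:
  assumes "p \<ge> 1" "\<theta> \<ge> 0" "\<zeta> \<in> nonneg_orthant" "x \<in> nonneg_orthant"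
  shows "\<bar>robust_violation p \<theta> b x \<zeta>\<bar> \<le> \<bar>b\<bar> + norm x * norm \<zeta>"
proof -
  let ?m = "INF \<xi>\<in>perturbations p \<theta> \<zeta>. \<xi> \<bullet> x"
  have "0 \<le> ?m"
    using center_in_perturbations[OF assms(1-3)]
    by (intro cINF_greatest) (auto simp: perturbations_def inner_nonneg_orthant assms(4))
  moreover have "?m \<le> \<zeta> \<bullet> x"
    by (intro cINF_lower bdd_below_perturbations center_in_perturbations assms)
  moreover have "\<zeta> \<bullet> x \<le> norm x * norm \<zeta>"
    using norm_cauchy_schwarz[of \<zeta> x] by (simp add: mult.commute)
  ultimately show ?thesis by (simp add: robust_violation_eq)
qed

section \<open>Permutations of the coordinates\<close>

definition reindex_vec :: "('n \<Rightarrow> 'n) \<Rightarrow> 'a ^ 'n \<Rightarrow> 'a ^ 'n" where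
  "reindex_vec \<pi> x = (\<chi> i. x $ \<pi> i)"

lemma reindex_vec_nth [simp]: "reindex_vec \<pi> x $ i = x $ \<pi> i"
  by (simp add: reindex_vec_def)

lemma lp_norm_reindex_vec:
  fixes x :: "real ^ 'n"
  assumes "bij \<pi>"
  shows "lp_norm p (reindex_vec \<pi> x) = lp_norm p x"
proof -
  have "(\<Sum>i\<in>UNIV. \<bar>x $ \<pi> i\<bar> powr q) = (\<Sum>i\<in>UNIV. \<bar>x $ i\<bar> powr q)" for q
    using sum.reindex_bij_betw[OF assms, of "\<lambda>i. \<bar>x $ i\<bar> powr q"] by simp
  moreover have "{\<bar>x $ \<pi> i\<bar> |i. i \<in> UNIV} = {\<bar>x $ i\<bar> |i. i \<in> UNIV}"
    using bij_is_surj[OF assms] by (auto simp: surj_def) metis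
  ultimately show ?thesis
    by (simp add: lp_norm_def infnorm_cart)
qed

lemma inner_reindex_vec:
  fixes x y :: "real ^ 'n"
  assumes "bij \<pi>"
  shows "reindex_vec \<pi> x \<bullet> reindex_vec \<pi> y = x \<bullet> y"
  using sum.reindex_bij_betw[OF assms, of "\<lambda>i. x $ i * y $ i"] by (simp add: inner_vec_def)

lemma perturbations_reindex_vec:
  fixes \<zeta> :: "real ^ 'n"
  assumes "bij \<pi>"
  shows "perturbations p \<theta> (reindex_vec \<pi> \<zeta>) = reindex_vec \<pi> ` perturbations p \<theta> \<zeta>"
proof -
  have diff: "reindex_vec \<pi> \<xi> - reindex_vec \<pi> \<zeta> = reindex_vec \<pi> (\<xi> - \<zeta>)" for \<xi> \<zeta> :: "real ^ 'n"
    by (simp add: vec_eq_iff)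
  have mem: "reindex_vec \<pi> \<xi> \<in> perturbations p \<theta> (reindex_vec \<pi> \<zeta>) \<longleftrightarrow> \<xi> \<in> perturbations p \<theta> \<zeta>"
    for \<xi> \<zeta> :: "real ^ 'n"
  proof -
    have "(\<forall>i. 0 \<le> \<xi> $ \<pi> i) \<longleftrightarrow> (\<forall>i. 0 \<le> \<xi> $ i)"
      using bij_is_surj[OF assms] by (metis surjD)
    then show ?thesis
      by (simp add: perturbations_def nonneg_orthant_def diff lp_norm_reindex_vec[OF assms])
  qed
  show ?thesis
  proof (intro subset_antisym subsetI)
    fix \<xi> assume \<xi>: "\<xi> \<in> perturbations p \<theta> (reindex_vec \<pi> \<zeta>)"
    have eq: "\<xi> = reindex_vec \<pi> (reindex_vec (inv \<pi>) \<xi>)"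
      using assms by (simp add: vec_eq_iff bij_is_inj)
    then have "reindex_vec (inv \<pi>) \<xi> \<in> perturbations p \<theta> \<zeta>"
      using \<xi> mem by metis
    with eq show "\<xi> \<in> reindex_vec \<pi> ` perturbations p \<theta> \<zeta>"
      by (rule image_eqI)
  qed (auto simp: mem)
qed

lemma robust_violation_reindex_vec:
  fixes x \<zeta> :: "real ^ 'n"
  assumes "bij \<pi>"
  shows "robust_violation p \<theta> b (reindex_vec \<pi> x) (reindex_vec \<pi> \<zeta>) = robust_violation p \<theta> b x \<zeta>"
  by (simp add: robust_violation_eq perturbations_reindex_vec[OF assms] image_image
      inner_reindex_vec[OF assms])

text \<open>Turns the comparison of support sizes into a permutation moving one support into the other:
  match \<open>A\<close> with a part of \<open>B\<close> of the same size, and the two complements with each other.\<close>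

lemma exists_bij_mapping_into:
  fixes A B :: "'n::finite set"
  assumes "card A \<le> card B"
  obtains \<pi> where "bij \<pi>" "\<pi> ` A \<subseteq> B"
proof -
  obtain B' where B': "B' \<subseteq> B" "card B' = card A"
    using obtain_subset_with_card_n[OF assms] by metis
  obtain f where f: "bij_betw f A B'"
    using finite_same_card_bij[of A B'] B' by auto
  obtain g where g: "bij_betw g (- A) (- B')"
    using finite_same_card_bij[of "- A" "- B'"] B' by (auto simp: card_Diff_subset Compl_eq_Diff_UNIV)
  have "bij_betw (\<lambda>i. if i \<in> A then f i else g i) (A \<union> - A) (B' \<union> - B')"
    using f g by (intro bij_betw_disjoint_Un) auto
  moreover have "(\<lambda>i. if i \<in> A then f i else g i) ` A \<subseteq> B"
    using f B' by (auto simp: bij_betw_def)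
  ultimately show thesis by (intro that[of "\<lambda>i. if i \<in> A then f i else g i"]) simp_all
qed

lemma measurable_reindex_vec: "reindex_vec \<pi> \<in> borel_measurable (borel :: (real ^ 'n) measure)"
  unfolding reindex_vec_def[abs_def]
  by (intro borel_measurable_continuous_onI continuous_intros)

text \<open>Independence identifies the joint law of the coordinates with the product
  \<open>Q\<close> of copies of one law \<open>D\<close>, and such a product is unchanged when its index set is permuted.
  Since product measures live on functions, the law is carried over to vectors by \<open>vec_lambda\<close>.\<close>

lemma (in prob_space) distr_reindex_vec_iid:
  fixes X :: "'a \<Rightarrow> real ^ 'n"
  assumes X: "random_variable borel X"
    and indep: "indep_vars (\<lambda>_. borel) (\<lambda>i \<omega>. X \<omega> $ i) UNIV"
    and ident: "\<And>i j. distr M borel (\<lambda>\<omega>. X \<omega> $ i) = distr M borel (\<lambda>\<omega>. X \<omega> $ j)"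
    and \<pi>: "bij \<pi>"
  shows "distr M borel (\<lambda>\<omega>. reindex_vec \<pi> (X \<omega>)) = distr M borel X"
proof -
  define D where "D = distr M borel (\<lambda>\<omega>. X \<omega> $ undefined)"
  define Q where "Q = PiM (UNIV :: 'n set) (\<lambda>_. D)"
  have nth: "random_variable borel (\<lambda>\<omega>. X \<omega> $ i)" for i
    by (rule measurable_compose[OF X]) (intro borel_measurable_continuous_onI continuous_intros)
  interpret D: prob_space D
    unfolding D_def by (rule prob_space_distr[OF nth])
  have sets_Q: "sets Q = sets (PiM UNIV (\<lambda>_. borel))"
    unfolding Q_def D_def by (intro sets_PiM_cong) simp_all
  have Q: "distr M (PiM UNIV (\<lambda>_. borel)) (\<lambda>\<omega> i. X \<omega> $ i) = Q"
  proof -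
    have D_eq: "distr M borel (\<lambda>\<omega>. X \<omega> $ i) = D" for i
      unfolding D_def by (rule ident)
    show ?thesis
      using indep nth by (subst (asm) indep_vars_iff_distr_eq_PiM) (auto simp: D_eq Q_def restrict_UNIV)
  qed
  have Q_reindex: "distr Q Q (\<lambda>f i. f (\<pi> i)) = Q"
    using distr_PiM_reindex[of UNIV "\<lambda>_. D" \<pi> UNIV] bij_is_inj[OF \<pi>] D.prob_space_axioms
    by (simp add: Q_def restrict_UNIV)
  have to_vec: "(\<lambda>f. \<chi> i. f i) \<in> PiM UNIV (\<lambda>_. borel) \<rightarrow>\<^sub>M (borel :: (real ^ 'n) measure)"
  proof (rule borel_measurable_euclidean_space[THEN iffD2], rule ballI)
    fix b :: "real ^ 'n" assume "b \<in> Basis"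
    then obtain i where "b = axis i 1" by (auto simp: Basis_vec_def)
    then have "(\<lambda>f. (\<chi> i. f i) \<bullet> b) = (\<lambda>f. f i)" by (simp add: inner_axis)
    then show "(\<lambda>f. (\<chi> i. f i) \<bullet> b) \<in> PiM UNIV (\<lambda>_. borel) \<rightarrow>\<^sub>M borel"
      by (simp add: measurable_component_singleton)
  qed
  have to_vec_Q: "(\<lambda>f. \<chi> i. f i) \<in> Q \<rightarrow>\<^sub>M (borel :: (real ^ 'n) measure)"
    using to_vec by (subst measurable_cong_sets[OF sets_Q refl])
  have X_Q: "(\<lambda>\<omega> i. X \<omega> $ i) \<in> M \<rightarrow>\<^sub>M PiM UNIV (\<lambda>_. borel)"
    using nth by (intro measurable_PiM_single') auto
  have R: "(\<lambda>f i. f (\<pi> i)) \<in> Q \<rightarrow>\<^sub>M Q"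
    unfolding Q_def by (intro measurable_PiM_single') (auto simp: space_PiM)
  have "distr M borel X = distr (distr M (PiM UNIV (\<lambda>_. borel)) (\<lambda>\<omega> i. X \<omega> $ i)) borel (\<lambda>f. \<chi> i. f i)"
    by (simp add: distr_distr[OF to_vec X_Q] comp_def)
  then have X_eq: "distr M borel X = distr Q borel (\<lambda>f. \<chi> i. f i)"
    by (simp add: Q)
  also have "\<dots> = distr (distr Q Q (\<lambda>f i. f (\<pi> i))) borel (\<lambda>f. \<chi> i. f i)"
    by (simp only: Q_reindex)
  also have "\<dots> = distr Q borel (\<lambda>f. \<chi> i. f (\<pi> i))"
    by (simp add: distr_distr[OF to_vec_Q R] comp_def)
  also have "\<dots> = distr (distr Q borel (\<lambda>f. \<chi> i. f i)) borel (reindex_vec \<pi>)"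
    by (simp add: distr_distr[OF measurable_reindex_vec to_vec_Q] comp_def reindex_vec_def)
  also have "\<dots> = distr (distr M borel X) borel (reindex_vec \<pi>)"
    by (simp only: X_eq)
  also have "\<dots> = distr M borel (\<lambda>\<omega>. reindex_vec \<pi> (X \<omega>))"
    by (simp add: distr_distr[OF measurable_reindex_vec X] comp_def)
  finally show ?thesis by simp
qed

section \<open>Integrability\<close>

text \<open>The norm is at most the number of \<open>k = 0, 1, 2, \<dots>\<close> with \<open>k \<le> norm \<zeta>\<close>, so its expectation is
  at most the sum of the tail probabilities. As \<open>k \<le> k\<^sup>2\<close>, a geometric series dominates these.\<close>

lemma integrable_norm_of_sub_gaussian:
  fixes P :: "(real ^ 'n) measure"
  assumes "prob_space P" and sets_P: "sets P = sets borel" and "sub_gaussian P"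
  shows "integrable P norm"
proof -
  interpret prob_space P by fact
  obtain C1 C2 where C: "C1 > 0" "C2 > 0"
      "\<And>t. t \<ge> 0 \<Longrightarrow> prob {\<zeta> \<in> space P. norm \<zeta> \<ge> t} \<le> C1 * exp (- C2 * t\<^sup>2)"
    using assms(3) unfolding sub_gaussian_def by blast
  note [measurable_cong] = sets_P
  let ?A = "\<lambda>k::nat. {\<zeta> \<in> space P. norm \<zeta> \<ge> real k}"
  have A [measurable]: "?A k \<in> sets P" for k
    by measurable
  have bound: "ennreal (norm \<zeta>) \<le> (\<Sum>k. indicator (?A k) \<zeta>)" if "\<zeta> \<in> space P" for \<zeta>
  proof -
    define N where "N = nat \<lfloor>norm \<zeta>\<rfloor>"
    have N: "real N \<le> norm \<zeta>" "norm \<zeta> \<le> real (Suc N)"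
      unfolding N_def by (simp, linarith)
    have "ennreal (norm \<zeta>) \<le> ennreal (real (Suc N))"
      using N(2) by (rule ennreal_leI)
    also have "\<dots> = (\<Sum>k<Suc N. indicator (?A k) \<zeta>)"
    proof -
      have "(\<Sum>k<Suc N. indicator (?A k) \<zeta> :: ennreal) = (\<Sum>k<Suc N. 1)"
        using N(1) that by (intro sum.cong) (auto simp: indicator_def)
      then show ?thesis by (simp add: ennreal_of_nat_eq_real_of_nat)
    qed
    also have "\<dots> \<le> (\<Sum>k. indicator (?A k) \<zeta>)"
      by (rule sum_le_suminf) auto
    finally show ?thesis .
  qed
  have tail: "emeasure P (?A k) \<le> ennreal (C1 * exp (- C2) ^ k)" for k
  proof -
    have "real k \<le> (real k)\<^sup>2"
      by (cases k) (auto simp: power2_eq_square)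
    then have "exp (- C2 * (real k)\<^sup>2) \<le> exp (real k * (- C2))"
      using C(2) by (simp add: mult.commute)
    also have "\<dots> = exp (- C2) ^ k"
      by (rule exp_of_nat_mult)
    finally have "C1 * exp (- C2 * (real k)\<^sup>2) \<le> C1 * exp (- C2) ^ k"
      using C(1) by simp
    then show ?thesis
      using C(3)[of "real k"] unfolding emeasure_eq_measure by (intro ennreal_leI) linarith
  qed
  have "(\<integral>\<^sup>+\<zeta>. ennreal (norm \<zeta>) \<partial>P) \<le> (\<integral>\<^sup>+\<zeta>. (\<Sum>k. indicator (?A k) \<zeta>) \<partial>P)"
    by (intro nn_integral_mono bound)
  also have "\<dots> = (\<Sum>k. emeasure P (?A k))"
    by (subst nn_integral_suminf) auto
  also have "\<dots> \<le> (\<Sum>k. ennreal (C1 * exp (- C2) ^ k))"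
    by (intro suminf_le tail) auto
  also have "\<dots> < \<infinity>"
  proof -
    have "summable (\<lambda>k. C1 * exp (- C2) ^ k)"
      using C(2) by (intro summable_mult summable_geometric) simp
    then show ?thesis
      using C(1) by (subst suminf_ennreal2) auto
  qed
  finally show ?thesis
    by (intro integrableI_bounded) auto
qed

lemma integrable_robust_violation:
  fixes P :: "(real ^ 'n) measure"
  assumes "prob_space P" "sets P = sets borel" "integrable P norm"
    and "AE \<zeta> in P. \<zeta> \<in> nonneg_orthant"
    and "p \<ge> 1" "\<theta> \<ge> 0" "x \<in> nonneg_orthant"
  shows "integrable P (robust_violation p \<theta> b x)"
proof (rule Bochner_Integration.integrable_bound)
  interpret prob_space P by fact
  show "integrable P (\<lambda>\<zeta>. \<bar>b\<bar> + norm x * norm \<zeta>)"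
    using assms(3) by simp
  show "robust_violation p \<theta> b x \<in> borel_measurable P"
    using borel_measurable_robust_violation[OF assms(5,7)]
    by (simp add: measurable_cong_sets[OF assms(2) refl])
  show "AE \<zeta> in P. norm (robust_violation p \<theta> b x \<zeta>) \<le> norm (\<bar>b\<bar> + norm x * norm \<zeta>)"
    using assms(4)
  proof eventually_elim
    case (elim \<zeta>)
    then show ?case using abs_robust_violation_le[OF assms(5,6) elim assms(7), of b] by simp
  qed
qed

section \<open>Comparing decisions and minimizing over the threshold\<close>

text \<open>Permuting the coordinates of both arguments changes nothing, so \<open>x\<close> may be permuted until it
  dominates \<open>y\<close> coordinatewise. The permutation left on \<open>\<zeta>\<close> disappears once an exchangeable law is
  averaged over.\<close>

lemma robust_violation_le_after_reindexing:
  fixes x y \<zeta> :: "real ^ 'n"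
  assumes "p \<ge> 1" "\<theta> \<ge> 0" "\<zeta> \<in> nonneg_orthant" "y \<in> nonneg_orthant"
    and "bij \<pi>" "\<And>i. y $ i \<le> x $ \<pi> i"
  shows "robust_violation p \<theta> b x \<zeta> \<le> robust_violation p \<theta> b y (reindex_vec \<pi> \<zeta>)"
proof -
  have "reindex_vec \<pi> \<zeta> \<in> nonneg_orthant"
    using assms(3) by (simp add: nonneg_orthant_def)
  then have "robust_violation p \<theta> b (reindex_vec \<pi> x) (reindex_vec \<pi> \<zeta>)
      \<le> robust_violation p \<theta> b y (reindex_vec \<pi> \<zeta>)"
    using assms by (intro robust_violation_antimono) auto
  then show ?thesis by (simp add: robust_violation_reindex_vec[OF assms(5)])
qed

text \<open>The expected excess is 1-Lipschitz in \<open>\<beta>\<close>, and by \<open>(g - \<beta>)\<^sub>+ \<ge> g - \<beta>\<close> the objective is at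
  least \<open>E g - (1 - \<epsilon>) \<beta>\<close>. Below a compact interval \<open>{-K..0}\<close> it is therefore no smaller than at
  \<open>0\<close>, and on the interval it attains its minimum.\<close>

lemma also_x_sharp_objective_attains_min_beta:
  fixes P :: "(real ^ 'n) measure"
  assumes "prob_space P" and g: "integrable P (robust_violation p \<theta> b x)" and "\<epsilon> < 1"
  obtains \<beta> where "\<beta> \<le> 0"
    "\<And>\<gamma>. \<gamma> \<le> 0 \<Longrightarrow> also_x_sharp_objective P p \<theta> b \<epsilon> (x, \<beta>) \<le> also_x_sharp_objective P p \<theta> b \<epsilon> (x, \<gamma>)"
proof -
  interpret prob_space P by fact
  let ?g = "robust_violation p \<theta> b x"
  define H where "H \<beta> = (\<integral>\<zeta>. max (?g \<zeta> - \<beta>) 0 \<partial>P)" for \<beta>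
  define F where "F \<beta> = \<epsilon> * \<beta> + H \<beta>" for \<beta>
  have F: "also_x_sharp_objective P p \<theta> b \<epsilon> (x, \<beta>) = F \<beta>" for \<beta>
    by (simp add: also_x_sharp_objective_def F_def H_def)
  have int: "integrable P (\<lambda>\<zeta>. max (?g \<zeta> - \<beta>) 0)" for \<beta>
    using g by (intro integrable_max) auto
  have "1-lipschitz_on UNIV H"
  proof (rule lipschitz_onI)
    fix \<beta> \<gamma> :: real
    have "dist (H \<beta>) (H \<gamma>) = \<bar>\<integral>\<zeta>. max (?g \<zeta> - \<beta>) 0 - max (?g \<zeta> - \<gamma>) 0 \<partial>P\<bar>"
      unfolding H_def dist_real_def by (simp add: Bochner_Integration.integral_diff[OF int int])
    also have "\<dots> \<le> (\<integral>\<zeta>. \<bar>max (?g \<zeta> - \<beta>) 0 - max (?g \<zeta> - \<gamma>) 0\<bar> \<partial>P)"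
      by (rule integral_abs_bound)
    also have "\<dots> \<le> (\<integral>\<zeta>. \<bar>\<beta> - \<gamma>\<bar> \<partial>P)"
      using int by (intro integral_mono integrable_abs Bochner_Integration.integrable_diff) auto
    finally show "dist (H \<beta>) (H \<gamma>) \<le> 1 * dist \<beta> \<gamma>"
      by (simp add: dist_real_def prob_space)
  qed simp
  then have cont: "continuous_on A F" for A
    unfolding F_def[abs_def]
    by (intro continuous_intros continuous_on_subset[OF lipschitz_on_continuous_on]) auto
  have coercive: "F \<beta> \<ge> expectation ?g - (1 - \<epsilon>) * \<beta>" for \<beta>
  proof -
    have "expectation ?g - \<beta> = (\<integral>\<zeta>. ?g \<zeta> - \<beta> \<partial>P)"
      using g by (simp add: prob_space)
    also have "\<dots> \<le> H \<beta>"
      unfolding H_def using g int by (intro integral_mono) auto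
    finally show ?thesis by (simp add: F_def algebra_simps)
  qed
  \<comment> \<open>\<open>- K\<close> is the point where the linear lower bound reaches \<open>F 0\<close>.\<close>
  define K where "K = (F 0 - expectation ?g) / (1 - \<epsilon>)"
  have "K \<ge> 0"
    using coercive[of 0] assms(3) by (simp add: K_def)
  then obtain \<beta> where \<beta>: "\<beta> \<in> {-K..0}" "\<And>\<gamma>. \<gamma> \<in> {-K..0} \<Longrightarrow> F \<beta> \<le> F \<gamma>"
    using continuous_attains_inf[OF compact_Icc _ cont, of "-K" 0] by force
  have "F \<beta> \<le> F \<gamma>" if "\<gamma> \<le> 0" for \<gamma>
  proof (cases "\<gamma> \<ge> - K")
    case True
    then show ?thesis using \<beta>(2) that by simp
  next
    case False
    have "F \<beta> \<le> F 0" using \<beta>(2)[of 0] \<open>K \<ge> 0\<close> by simp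
    also have "F 0 = expectation ?g + (1 - \<epsilon>) * K"
      using assms(3) by (simp add: K_def)
    also have "\<dots> \<le> expectation ?g + (1 - \<epsilon>) * (- \<gamma>)"
      using False assms(3) by (intro add_left_mono mult_left_mono) auto
    also have "\<dots> \<le> F \<gamma>" using coercive[of \<gamma>] by simp
    finally show ?thesis .
  qed
  then show thesis using \<beta>(1) by (intro that[of \<beta>]) (auto simp: F)
qed

section \<open>Exactness\<close>

theorem corollary7:
  fixes P :: "(real ^ 'n) measure" and X :: "(real ^ 'n) set" and c :: "real ^ 'n"
    and p :: ennreal and \<theta> b1 \<epsilon> :: real
  assumes "prob_space P" and "sets P = sets borel"
    and "sub_gaussian P"
    and "prob_space.indep_vars P (\<lambda>_. borel) (\<lambda>i \<zeta>. \<zeta> $ i) (UNIV :: 'n set)"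
    and "\<And>i j. distr P borel (\<lambda>\<zeta>. \<zeta> $ i) = distr P borel (\<lambda>\<zeta>. \<zeta> $ j)"
    and "AE \<zeta> in P. \<zeta> \<in> nonneg_orthant"
    and "p \<ge> 1" and "\<theta> \<ge> 0" and "b1 \<ge> 0" and "0 < \<epsilon>" and "\<epsilon> < 1"
    and "X \<subseteq> {x. \<forall>i. x $ i \<in> {0, 1}}"
  shows "also_x_sharp_value P p \<theta> b1 \<epsilon> X c = drccp_value P p \<theta> b1 \<epsilon> X c"
proof -
  interpret prob_space P by fact
  let ?g = "robust_violation p \<theta> b1"
  let ?F = "also_x_sharp_objective P p \<theta> b1 \<epsilon>"
  let ?pr = "\<lambda>x. \<P>(\<zeta> in P. ?g x \<zeta> \<le> 0)"
  have space_P: "space P = UNIV"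
    using sets_eq_imp_space_eq[OF assms(2)] by simp
  note meas_P = measurable_cong_sets[OF assms(2) refl]
  have nonneg: "x \<in> nonneg_orthant" if "x \<in> X" for x
  proof -
    have "0 \<le> x $ i" for i
    proof -
      have "x $ i \<in> {0, 1}" using that assms(12) by blast
      then show ?thesis by auto
    qed
    then show ?thesis by (simp add: nonneg_orthant_def)
  qed
  have meas: "?g x \<in> borel_measurable borel" if "x \<in> X" for x
    by (rule borel_measurable_robust_violation[OF assms(7) nonneg[OF that]])
  have integrable: "integrable P (?g x)" if "x \<in> X" for x
    by (rule integrable_robust_violation[OF assms(1,2)
          integrable_norm_of_sub_gaussian[OF assms(1-3)] assms(6-8) nonneg[OF that]])
  have invariant: "distr P borel (reindex_vec \<pi>) = P" if "bij \<pi>" for \<pi> :: "'n \<Rightarrow> 'n"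
    using distr_reindex_vec_iid[of "\<lambda>\<zeta>. \<zeta>" \<pi>] that assms(2,4,5)
    by (simp add: distr_id2 meas_P)

  define supp where "supp x = {i. x $ i = 1}" for x :: "real ^ 'n"
  have dominates: "?F (x, \<beta>) \<le> ?F (y, \<beta>) \<and> ?pr y \<le> ?pr x"
    if x: "x \<in> X" and y: "y \<in> X" and card: "card (supp y) \<le> card (supp x)" for x y \<beta>
  proof -
    obtain \<pi> where \<pi>: "bij \<pi>" "\<pi> ` supp y \<subseteq> supp x"
      using exists_bij_mapping_into[OF card] by blast
    have "y $ i \<le> x $ \<pi> i" for i
    proof -
      have "y $ i \<in> {0, 1}" "x $ \<pi> i \<in> {0, 1}" using x y assms(12) by blast+
      then show ?thesis using \<pi>(2) by (auto simp: supp_def)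
    qed
    then have le: "?g x \<zeta> \<le> ?g y (reindex_vec \<pi> \<zeta>)" if "\<zeta> \<in> nonneg_orthant" for \<zeta>
      using robust_violation_le_after_reindexing[OF assms(7,8) that nonneg[OF y] \<pi>(1)] by blast
    have reindex: "reindex_vec \<pi> \<in> P \<rightarrow>\<^sub>M borel"
      using measurable_reindex_vec by (simp add: meas_P)
    have int_max: "integrable P (\<lambda>\<zeta>. max (?g z \<zeta> - \<beta>) 0)" if "z \<in> X" for z
      using integrable[OF that] by (intro integrable_max) auto
    have meas_max: "(\<lambda>\<zeta>. max (?g y \<zeta> - \<beta>) 0) \<in> borel_measurable borel"
      using meas[OF y] by measurable
    have "(\<integral>\<zeta>. max (?g x \<zeta> - \<beta>) 0 \<partial>P) \<le> (\<integral>\<zeta>. max (?g y (reindex_vec \<pi> \<zeta>) - \<beta>) 0 \<partial>P)"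
    proof (rule integral_mono_AE[OF int_max[OF x]])
      show "integrable P (\<lambda>\<zeta>. max (?g y (reindex_vec \<pi> \<zeta>) - \<beta>) 0)"
        using int_max[OF y] integrable_distr_eq[OF reindex meas_max]
        by (simp add: invariant[OF \<pi>(1)])
      show "AE \<zeta> in P. max (?g x \<zeta> - \<beta>) 0 \<le> max (?g y (reindex_vec \<pi> \<zeta>) - \<beta>) 0"
        using assms(6)
      proof eventually_elim
        case (elim \<zeta>)
        then show ?case using le[OF elim] by (auto simp: max_def)
      qed
    qed
    also have "\<dots> = (\<integral>\<zeta>. max (?g y \<zeta> - \<beta>) 0 \<partial>P)"
      using integral_distr[OF reindex meas_max] by (simp add: invariant[OF \<pi>(1)])
    finally have "?F (x, \<beta>) \<le> ?F (y, \<beta>)"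
      by (simp add: also_x_sharp_objective_def)
    moreover have "?pr y \<le> ?pr x"
    proof -
      have S: "{\<zeta>. ?g z \<zeta> \<le> 0} \<in> sets borel" if "z \<in> X" for z
        using meas[OF that] by measurable
      have "prob {\<zeta>. ?g y \<zeta> \<le> 0} = prob {\<zeta>. ?g y (reindex_vec \<pi> \<zeta>) \<le> 0}"
        using measure_distr[OF reindex S[OF y]] by (simp add: invariant[OF \<pi>(1)] space_P vimage_def)
      also have "\<dots> \<le> prob {\<zeta>. ?g x \<zeta> \<le> 0}"
      proof (rule finite_measure_mono_AE)
        show "{\<zeta>. ?g x \<zeta> \<le> 0} \<in> events" using S[OF x] by (simp add: assms(2))
        show "AE \<zeta> in P. \<zeta> \<in> {\<zeta>. ?g y (reindex_vec \<pi> \<zeta>) \<le> 0} \<longrightarrow> \<zeta> \<in> {\<zeta>. ?g x \<zeta> \<le> 0}"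
          using assms(6)
        proof eventually_elim
          case (elim \<zeta>)
          then show ?case using le[OF elim] by auto
        qed
      qed
      finally show ?thesis by (simp add: space_P)
    qed
    ultimately show ?thesis by blast
  qed

  show ?thesis
  proof (rule antisym)
    show "drccp_value P p \<theta> b1 \<epsilon> X c \<le> also_x_sharp_value P p \<theta> b1 \<epsilon> X c"
      unfolding also_x_sharp_value_def
    proof (rule INF_greatest)
      fix t
      assume "t \<in> {t. \<exists>x \<beta>. is_arg_min ?F (\<lambda>(x, \<beta>). x \<in> X \<and> c \<bullet> x \<le> t \<and> \<beta> \<le> 0) (x, \<beta>)
        \<and> ?pr x \<ge> 1 - \<epsilon>}"
      then obtain x where x: "x \<in> X" "c \<bullet> x \<le> t" "?pr x \<ge> 1 - \<epsilon>"
        by (auto simp: is_arg_min_def)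
      then have "drccp_value P p \<theta> b1 \<epsilon> X c \<le> ereal (c \<bullet> x)"
        unfolding drccp_value_def by (intro INF_lower) auto
      also have "\<dots> \<le> ereal t" using x by simp
      finally show "drccp_value P p \<theta> b1 \<epsilon> X c \<le> ereal t" .
    qed
  next
    show "also_x_sharp_value P p \<theta> b1 \<epsilon> X c \<le> drccp_value P p \<theta> b1 \<epsilon> X c"
      unfolding drccp_value_def
    proof (rule INF_greatest)
      fix y assume "y \<in> {x \<in> X. ?pr x \<ge> 1 - \<epsilon>}"
      then have y: "y \<in> X" "?pr y \<ge> 1 - \<epsilon>" by auto
      \<comment> \<open>Supports have at most \<open>CARD('n)\<close> elements, so a largest one exists.\<close>
      have "\<exists>x. (x \<in> X \<and> c \<bullet> x \<le> c \<bullet> y) \<and>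
          (\<forall>z. z \<in> X \<and> c \<bullet> z \<le> c \<bullet> y \<longrightarrow> card (supp z) \<le> card (supp x))"
        using y(1)
        by (intro ex_has_greatest_nat[where k = y and b = "Suc CARD('n)"])
          (auto simp: less_Suc_eq_le intro: card_mono)
      then obtain x where x: "x \<in> X" "c \<bullet> x \<le> c \<bullet> y"
          and max: "\<And>z. z \<in> X \<Longrightarrow> c \<bullet> z \<le> c \<bullet> y \<Longrightarrow> card (supp z) \<le> card (supp x)"
        by blast
      obtain \<beta> where \<beta>: "\<beta> \<le> 0" "\<And>\<gamma>. \<gamma> \<le> 0 \<Longrightarrow> ?F (x, \<beta>) \<le> ?F (x, \<gamma>)"
        using also_x_sharp_objective_attains_min_beta[OF assms(1) integrable[OF x(1)] assms(11)]
        by blast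
      have "?F (x, \<beta>) \<le> ?F (z, \<gamma>)" if "z \<in> X" "c \<bullet> z \<le> c \<bullet> y" "\<gamma> \<le> 0" for z \<gamma>
        using \<beta>(2)[OF that(3)] dominates[OF x(1) that(1) max[OF that(1,2)], of \<gamma>] by linarith
      then have "is_arg_min ?F (\<lambda>(x, \<beta>). x \<in> X \<and> c \<bullet> x \<le> c \<bullet> y \<and> \<beta> \<le> 0) (x, \<beta>)"
        using x \<beta>(1) by (auto simp: is_arg_min_def not_less)
      moreover have "?pr x \<ge> 1 - \<epsilon>"
        using dominates[OF x(1) y(1) max[OF y(1)]] y(2) by force
      ultimately show "also_x_sharp_value P p \<theta> b1 \<epsilon> X c \<le> ereal (c \<bullet> y)"
        unfolding also_x_sharp_value_def by (intro INF_lower) blast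
    qed
  qed
qed

end
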